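(* Let $n\ge 4$ and let $W_n$ be the wheel of order $n$. Then the central graph $C(W_n)$ satisfies $\gamma_p(C(W_n))=2$.
   Context: All graphs are finite, simple and undirected. $N[v]$ denotes the closed neighborhood of $v$ and $N[S]=\bigcup_{v\in S}N[v]$. For $U\subseteq V(G)$, the closure $cl(U)$ is the set obtained from $U$ by repeatedly applying, until no more changes are possible, the rule: if a vertex $u$ is in the current set and exactly one neighbor $w$ of $u$ is not in it, then add $w$. A set $S\subseteq V(G)$ is a power dominating set of $G$ if $cl(N[S])=V(G)$, and the power domination number $\gamma_p(G)$ is the minimum cardinality of a power dominating set. The wheel $W_n$ of order $n$ consists of a cycle $C_{n-1}$ together with one additional vertex adjacent to all vertices of the cycle. The central graph $C(G)$ of a graph $G$ is obtained by subdividing each edge of $G$ exactly once (inserting one new vertex on each edge) and then joining by an edge every pair of distinct vertices of $G$ that are non-adjacent in $G$. *)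

theory Defs
  imports Main
begin

record 'a ugraph =
  verts :: "'a set"
  edges :: "'a set set"

definition simple_graph :: "'a ugraph \<Rightarrow> bool" where
  "simple_graph G \<longleftrightarrow> finite (verts G) \<and> (\<forall>e\<in>edges G. e \<subseteq> verts G \<and> card e = 2)"

definition nbhd :: "'a ugraph \<Rightarrow> 'a \<Rightarrow> 'a set" where
  "nbhd G v = {w. {v, w} \<in> edges G}"

definition closed_nbhd :: "'a ugraph \<Rightarrow> 'a \<Rightarrow> 'a set" where
  "closed_nbhd G v = insert v (nbhd G v)"

definition closed_nbhd_set :: "'a ugraph \<Rightarrow> 'a set \<Rightarrow> 'a set" where
  "closed_nbhd_set G S = (\<Union>v\<in>S. closed_nbhd G v)"

inductive force_step :: "'a ugraph \<Rightarrow> 'a set \<Rightarrow> 'a set \<Rightarrow> bool" for G where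
  "u \<in> U \<Longrightarrow> nbhd G u - U = {w} \<Longrightarrow> force_step G U (insert w U)"

definition force_result :: "'a ugraph \<Rightarrow> 'a set \<Rightarrow> 'a set \<Rightarrow> bool" where
  "force_result G U X \<longleftrightarrow> (force_step G)\<^sup>*\<^sup>* U X \<and> (\<nexists>Y. force_step G X Y)"

text \<open>The description below is legitimate because the outcome exists and does not depend on
  the order of the steps; see \<open>ex1_force_result\<close>.\<close>

definition cl :: "'a ugraph \<Rightarrow> 'a set \<Rightarrow> 'a set" where
  "cl G U = (THE X. force_result G U X)"

definition power_dominating_set :: "'a ugraph \<Rightarrow> 'a set \<Rightarrow> bool" where
  "power_dominating_set G S \<longleftrightarrow> S \<subseteq> verts G \<and> cl G (closed_nbhd_set G S) = verts G"

definition power_domination_number :: "'a ugraph \<Rightarrow> nat" where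
  "power_domination_number G = (LEAST k. \<exists>S. power_dominating_set G S \<and> card S = k)"

text \<open>For \<open>m \<ge> 3\<close> this is the cycle with \<open>m\<close> vertices.\<close>

definition cycle_graph :: "nat \<Rightarrow> nat ugraph" where
  "cycle_graph m = \<lparr>verts = {..<m}, edges = {{i, (i + 1) mod m} | i. i < m}\<rparr>"

text \<open>The rim of the wheel of order \<open>n\<close> is the cycle on \<open>0, \<dots>, n - 2\<close>; the hub is
  \<open>n - 1\<close>.\<close>

definition wheel :: "nat \<Rightarrow> nat ugraph" where
  "wheel n = \<lparr>verts = insert (n - 1) (verts (cycle_graph (n - 1))),
     edges = edges (cycle_graph (n - 1)) \<union> {{n - 1, v} | v. v \<in> verts (cycle_graph (n - 1))}\<rparr>"

text \<open>\<open>Inl v\<close> is the original vertex \<open>v\<close>, and \<open>Inr e\<close> is the vertex that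
  subdivides the edge \<open>e\<close>.\<close>

definition central_graph :: "'a ugraph \<Rightarrow> ('a + 'a set) ugraph" where
  "central_graph G = \<lparr>verts = Inl ` verts G \<union> Inr ` edges G,
     edges = {{Inl v, Inr e} | v e. e \<in> edges G \<and> v \<in> e} \<union>
             {{Inl u, Inl v} | u v. u \<in> verts G \<and> v \<in> verts G \<and> u \<noteq> v \<and> {u, v} \<notin> edges G}\<rparr>"

lemma nbhd_subset_verts:
  assumes "simple_graph G"
  shows "nbhd G v \<subseteq> verts G"
  using assms by (auto simp: nbhd_def simple_graph_def)

lemma closed_nbhd_set_subset_verts:
  assumes "simple_graph G" "S \<subseteq> verts G"
  shows "closed_nbhd_set G S \<subseteq> verts G"
  using assms nbhd_subset_verts[OF assms(1)] by (auto simp: closed_nbhd_set_def closed_nbhd_def)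

lemma force_steps_subset:
  assumes "(force_step G)\<^sup>*\<^sup>* U X" "U \<subseteq> Y" "\<nexists>Z. force_step G Y Z"
  shows "X \<subseteq> Y"
  using assms(1)
proof (induction rule: rtranclp_induct)
  case base
  then show ?case using assms(2) .
next
  case (step X X')
  from step.hyps(2) obtain u w where X': "X' = insert w X" "u \<in> X" "nbhd G u - X = {w}"
    by (auto elim: force_step.cases)
  have "w \<in> Y"
  proof (rule ccontr)
    assume "w \<notin> Y"
    with X' step.IH have "nbhd G u - Y = {w}" "u \<in> Y" by auto
    then show False using assms(3) force_step.intros by metis
  qed
  with X' step.IH show ?case by simp
qed

lemma force_steps_mono: "(force_step G)\<^sup>*\<^sup>* U X \<Longrightarrow> U \<subseteq> X"
  by (induction rule: rtranclp_induct) (auto elim!: force_step.cases)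

lemma force_result_exists:
  assumes "simple_graph G" "U \<subseteq> verts G"
  shows "\<exists>X. force_result G U X"
  using assms(2)
proof (induction "card (verts G - U)" arbitrary: U rule: less_induct)
  case less
  show ?case
  proof (cases "\<exists>Y. force_step G U Y")
    case False
    then show ?thesis by (auto simp: force_result_def)
  next
    case True
    then obtain u w where s: "force_step G U (insert w U)" "nbhd G u - U = {w}"
      by (auto elim!: force_step.cases intro: force_step.intros)
    then have w: "w \<in> verts G" "w \<notin> U" using nbhd_subset_verts[OF assms(1)] by blast+
    have "finite (verts G)" using assms(1) by (simp add: simple_graph_def)
    then have "card (verts G - insert w U) < card (verts G - U)"
      using w by (intro psubset_card_mono) auto
    with less.hyps less.prems w obtain X where "force_result G (insert w U) X" by blast
    with s(1) show ?thesis
      unfolding force_result_def by (meson converse_rtranclp_into_rtranclp)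
  qed
qed

lemma ex1_force_result:
  assumes "simple_graph G" "U \<subseteq> verts G"
  shows "\<exists>!X. force_result G U X"
proof (rule ex_ex1I)
  show "\<exists>X. force_result G U X" using force_result_exists[OF assms] .
next
  fix X Y assume "force_result G U X" "force_result G U Y"
  then show "X = Y"
    by (meson force_result_def force_steps_mono force_steps_subset subset_antisym)
qed

lemma simple_graph_wheel:
  assumes "n \<ge> 4"
  shows "simple_graph (wheel n)"
proof -
  have "i \<noteq> (i + 1) mod (n - 1)" if "i < n - 1" for i
    using that assms by (cases "i + 1 = n - 1") auto
  then show ?thesis
    using assms by (auto simp: simple_graph_def wheel_def cycle_graph_def card_insert_if)
qed

lemma simple_graph_central_graph:
  assumes "simple_graph G"
  shows "simple_graph (central_graph G)"
proof -
  have "edges G \<subseteq> Pow (verts G)" "finite (verts G)"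
    using assms by (auto simp: simple_graph_def)
  then have "finite (edges G)" by (meson finite_Pow_iff finite_subset)
  then show ?thesis
    using assms by (auto simp: simple_graph_def central_graph_def card_insert_if)
qed

end

theory Submission
  imports Defs
begin

text \<open>
  In a central graph a subdivision vertex is adjacent only to the two ends of its edge. Take a
  nonempty set \<open>D\<close> of edges such that every vertex on \<open>D\<close> lies on at least two edges of \<open>D\<close>, for
  instance a cycle. As long as all vertices that subdivide \<open>D\<close> are unobserved, no vertex has
  exactly one neighbor among them, so none of them is ever forced. Hence if every vertex \<open>v\<close> of
  \<open>G\<close> is avoided by such a \<open>D\<close>, a single vertex cannot power dominate the central graph: neither
  an original vertex \<open>v\<close> nor the subdivision vertex of an edge at \<open>v\<close> observes anything of the \<open>D\<close>
  that avoids \<open>v\<close>. This is \<open>central_graph_power_dominating_set_card\<close>. In a wheel the rim avoids the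
  hub, and the triangle formed by the hub and the two rim vertices following a rim vertex \<open>i\<close>
  avoids \<open>i\<close>.

  Conversely, the hub and the rim vertex \<open>0\<close> suffice. The hub observes the subdivision vertices of
  all spokes, and these force all rim vertices. It remains to observe the subdivision vertices of
  the rim edges; \<open>0\<close> observes the one on \<open>{0, 1}\<close>, and from there the forcing runs around the rim,
  because each rim vertex lies on only two rim edges.
\<close>

section \<open>Closures and stalled sets\<close>

text \<open>Turns a closure, which is given by a definite description, into a statement about
  sets at which the forcing has stopped; both bounds use only this form.\<close>

lemma cl_eq_verts_iff:
  assumes "simple_graph G" "U \<subseteq> verts G"
  shows "cl G U = verts G \<longleftrightarrow>
    (\<forall>X. U \<subseteq> X \<longrightarrow> X \<subseteq> verts G \<longrightarrow> (\<nexists>Y. force_step G X Y) \<longrightarrow> X = verts G)"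
proof -
  have result: "force_result G U (cl G U)"
    unfolding cl_def using ex1_force_result[OF assms] by (rule theI')
  then have steps: "(force_step G)\<^sup>*\<^sup>* U (cl G U)" and stalled: "\<nexists>Y. force_step G (cl G U) Y"
    by (auto simp: force_result_def)
  have "\<nexists>Y. force_step G (verts G) Y"
    using nbhd_subset_verts[OF assms(1)] by (auto elim!: force_step.cases)
  then have "cl G U \<subseteq> verts G"
    using force_steps_subset[OF steps assms(2)] by blast
  moreover have "U \<subseteq> cl G U"
    using steps by (rule force_steps_mono)
  ultimately show ?thesis
    using stalled force_steps_subset[OF steps] by blast
qed

lemma forced_in_stalled_set:
  assumes "\<nexists>Y. force_step G X Y" "u \<in> X" "nbhd G u \<subseteq> insert w X" "w \<in> nbhd G u"
  shows "w \<in> X"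
proof (rule ccontr)
  assume "w \<notin> X"
  with assms(3,4) have "nbhd G u - X = {w}" by auto
  with assms(1,2) show False by (metis force_step.intros)
qed

text \<open>The obstruction is what is known as a fort: a nonempty set \<open>F\<close> that every outside vertex meets
  in no or in several neighbors.\<close>

lemma not_power_dominating_set_if_fort:
  assumes "simple_graph G" "F \<subseteq> verts G" "F \<noteq> {}"
    and fort: "\<And>u w. u \<notin> F \<Longrightarrow> nbhd G u \<inter> F \<noteq> {w}"
    and disjoint: "closed_nbhd_set G S \<inter> F = {}"
  shows "\<not> power_dominating_set G S"
proof
  assume S: "power_dominating_set G S"
  let ?X = "verts G - F"
  have sub: "closed_nbhd_set G S \<subseteq> verts G"
    using S closed_nbhd_set_subset_verts[OF assms(1)] by (simp add: power_dominating_set_def)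
  have "nbhd G u - ?X = nbhd G u \<inter> F" for u
    using nbhd_subset_verts[OF assms(1), of u] by auto
  then have "\<nexists>Y. force_step G ?X Y"
    using fort by (auto elim!: force_step.cases)
  moreover have "closed_nbhd_set G S \<subseteq> ?X"
    using sub disjoint by blast
  ultimately have "?X = verts G"
    using S cl_eq_verts_iff[OF assms(1) sub] by (auto simp: power_dominating_set_def)
  then show False
    using assms(2,3) by blast
qed

section \<open>Central graphs\<close>

lemma nbhd_central_graph_Inl:
  "nbhd (central_graph G) (Inl v) = Inr ` {e \<in> edges G. v \<in> e} \<union>
    Inl ` {u \<in> verts G. v \<in> verts G \<and> u \<noteq> v \<and> {u, v} \<notin> edges G}"
  by (auto simp: nbhd_def central_graph_def doubleton_eq_iff insert_commute)

lemma nbhd_central_graph_Inr: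
  "nbhd (central_graph G) (Inr e) = (if e \<in> edges G then Inl ` e else {})"
  by (auto simp: nbhd_def central_graph_def doubleton_eq_iff)

text \<open>The subdivision vertices of \<open>D\<close> form a fort: an original vertex has as many neighbors among
  them as it has edges in \<open>D\<close>, and distinct subdivision vertices are not adjacent. The condition on
  \<open>D\<close> is minimum degree two, which is all that is used of a cycle.\<close>

lemma central_graph_power_dominating_set_card:
  assumes "simple_graph G" "verts G \<noteq> {}"
    and avoid: "\<And>v. v \<in> verts G \<Longrightarrow> \<exists>D \<subseteq> edges G. D \<noteq> {} \<and> v \<notin> \<Union>D \<and>
      (\<forall>e\<in>D. \<forall>u\<in>e. \<exists>e'\<in>D. e' \<noteq> e \<and> u \<in> e')"
    and S: "power_dominating_set (central_graph G) S"
  shows "2 \<le> card S"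
proof (rule ccontr)
  assume "\<not> 2 \<le> card S"
  moreover have sub: "S \<subseteq> verts (central_graph G)"
    using S by (simp add: power_dominating_set_def)
  then have "finite S"
    using simple_graph_central_graph[OF assms(1)] by (auto simp: simple_graph_def intro: finite_subset)
  ultimately have "S = {} \<or> (\<exists>x. S = {x})"
    by (metis One_nat_def card_1_singletonE card_eq_0_iff less_2_cases not_le)
  \<comment> \<open>A subdivision vertex is treated like either end of its edge.\<close>
  then obtain v where v: "v \<in> verts G" and Sv: "S \<subseteq> insert (Inl v) (Inr ` {e \<in> edges G. v \<in> e})"
  proof (elim disjE exE)
    assume "S = {}"
    then show thesis using that assms(2) by blast
  next
    fix x assume x: "S = {x}"
    show thesis
    proof (cases x)
      case (Inl v)
      then show thesis using that[of v] x sub by (auto simp: central_graph_def)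
    next
      case (Inr e)
      then have e: "e \<in> edges G" using x sub by (auto simp: central_graph_def)
      then obtain v where "v \<in> e" "v \<in> verts G"
        using assms(1) by (fastforce simp: simple_graph_def card_2_iff)
      then show thesis using that[of v] x Inr e by auto
    qed
  qed
  from avoid[OF v] obtain D where D: "D \<subseteq> edges G" "D \<noteq> {}" "v \<notin> \<Union>D"
      and twice: "\<forall>e\<in>D. \<forall>u\<in>e. \<exists>e'\<in>D. e' \<noteq> e \<and> u \<in> e'"
    by (elim exE conjE)
  have "\<not> power_dominating_set (central_graph G) S"
  proof (rule not_power_dominating_set_if_fort)
    show "simple_graph (central_graph G)"
      using assms(1) by (rule simple_graph_central_graph)
    show "Inr ` D \<subseteq> verts (central_graph G)"
      using D(1) by (auto simp: central_graph_def)
    show "Inr ` D \<noteq> {}"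
      using D(2) by simp
    show "nbhd (central_graph G) u \<inter> Inr ` D \<noteq> {w}" for u w
    proof (cases u)
      case (Inl a)
      then have *: "nbhd (central_graph G) u \<inter> Inr ` D = Inr ` {e \<in> D. a \<in> e}"
        using D(1) by (auto simp: nbhd_central_graph_Inl)
      show ?thesis
      proof
        assume "nbhd (central_graph G) u \<inter> Inr ` D = {w}"
        with * have image: "Inr ` {e \<in> D. a \<in> e} = {w}" by simp
        then obtain e where e: "e \<in> D" "a \<in> e" "w = Inr e" by blast
        with twice obtain e' where "e' \<in> D" "e' \<noteq> e" "a \<in> e'" by blast
        with image e(3) show False by blast
      qed
    next
      case (Inr e)
      then have "nbhd (central_graph G) u \<inter> Inr ` D = {}"
        by (auto simp: nbhd_central_graph_Inr)
      then show ?thesis by simp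
    qed
    show "closed_nbhd_set (central_graph G) S \<inter> Inr ` D = {}"
    proof -
      have "closed_nbhd (central_graph G) x \<inter> Inr ` D = {}" if "x \<in> S" for x
      proof -
        from that Sv consider "x = Inl v" | e where "x = Inr e" "e \<in> edges G" "v \<in> e"
          by blast
        then show ?thesis
          using D(3) by cases (auto simp: closed_nbhd_def nbhd_central_graph_Inl nbhd_central_graph_Inr)
      qed
      then show ?thesis
        unfolding closed_nbhd_set_def by blast
    qed
  qed
  with S show False by blast
qed

section \<open>Wheels\<close>

lemma verts_wheel: "n \<ge> 1 \<Longrightarrow> verts (wheel n) = {..<n}"
  by (auto simp: wheel_def cycle_graph_def)

lemma edges_wheel:
  "edges (wheel n) =
    (\<lambda>i. {i, (i + 1) mod (n - 1)}) ` {..<n - 1} \<union> (\<lambda>i. {n - 1, i}) ` {..<n - 1}"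
  by (auto simp: wheel_def cycle_graph_def)

text \<open>For the hub, \<open>D\<close> is the rim; for a rim vertex, the triangle on the hub and the next two rim
  vertices, which differ from the given one because the rim has at least three vertices.\<close>

lemma wheel_cycle_avoiding_vertex:
  assumes "n \<ge> 4" "v \<in> verts (wheel n)"
  shows "\<exists>D \<subseteq> edges (wheel n). D \<noteq> {} \<and> v \<notin> \<Union>D \<and>
      (\<forall>e\<in>D. \<forall>u\<in>e. \<exists>e'\<in>D. e' \<noteq> e \<and> u \<in> e')"
proof -
  define m where "m = n - 1"
  have m: "m \<ge> 3" using assms(1) by (simp add: m_def)
  let ?s = "\<lambda>i. (i + 1) mod m"
  have next_less: "?s i < m" for i using m by simp
  have next_neq: "?s i \<noteq> i" "?s (?s i) \<noteq> i" if "i < m" for i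
    using that m by (auto simp: mod_Suc)
  have pred: "\<exists>j<m. ?s j = i" if "i < m" for i
  proof (cases i)
    case 0
    then show ?thesis using m by (intro exI[of _ "m - 1"]) auto
  next
    case (Suc j)
    then show ?thesis using that by (intro exI[of _ j]) auto
  qed
  show ?thesis
  proof (cases "v = m")
    case True
    let ?D = "(\<lambda>i. {i, ?s i}) ` {..<m}"
    have twice: "\<exists>e'\<in>?D. e' \<noteq> e \<and> u \<in> e'" if e: "e \<in> ?D" "u \<in> e" for e u
    proof -
      have "u < m" using e next_less by auto
      moreover obtain j where j: "j < m" "?s j = u" using pred \<open>u < m\<close> by blast
      moreover have "{u, ?s u} \<noteq> {j, u}"
        using next_neq[OF j(1)] next_neq[OF \<open>u < m\<close>] j(2) by (auto simp: doubleton_eq_iff)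
      ultimately have "{u, ?s u} \<in> ?D" "{j, u} \<in> ?D" "{u, ?s u} \<noteq> {j, u}" by auto
      then show ?thesis by (metis insertCI)
    qed
    have "?D \<subseteq> edges (wheel n)" by (auto simp: edges_wheel m_def)
    moreover have "m \<noteq> ?s i" for i using less_imp_neq[OF next_less] by (rule not_sym)
    then have "v \<notin> \<Union>?D" using True by auto
    moreover have "?D \<noteq> {}" using m by (simp add: lessThan_empty_iff)
    ultimately show ?thesis using twice by (intro exI[of _ ?D] conjI ballI)
  next
    case False
    then have v: "v < m" using assms by (auto simp: verts_wheel m_def)
    define j where "j = ?s v"
    define k where "k = ?s j"
    have jk: "j < m" "k < m" "j \<noteq> v" "k \<noteq> v" "k \<noteq> j"
      using next_less next_neq v unfolding j_def k_def by auto
    let ?D = "{{m, j}, {j, k}, {m, k}}"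
    have "{m, j} \<in> edges (wheel n)" "{m, k} \<in> edges (wheel n)"
      using jk by (auto simp: edges_wheel m_def)
    moreover have "{j, k} \<in> edges (wheel n)"
      using jk(1) by (auto simp: edges_wheel m_def k_def)
    ultimately have sub: "?D \<subseteq> edges (wheel n)"
      by simp
    have neq: "{m, j} \<noteq> {j, k}" "{m, j} \<noteq> {m, k}" "{j, k} \<noteq> {m, k}"
      using jk by (simp_all add: doubleton_eq_iff)
    have twice: "\<forall>e\<in>?D. \<forall>u\<in>e. \<exists>e'\<in>?D. e' \<noteq> e \<and> u \<in> e'"
      by (simp add: neq neq[symmetric])
    have "v \<notin> \<Union>?D" using jk v by auto
    moreover have "?D \<noteq> {}" by simp
    ultimately show ?thesis using sub twice by (intro exI[of _ ?D] conjI)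
  qed
qed

text \<open>The rim vertex in the set breaks the symmetry of the rim: with the hub alone, every rim
  vertex would be left with two unobserved neighbors.\<close>

lemma hub_and_rim_vertex_power_dominate:
  assumes "n \<ge> 4"
  shows "power_dominating_set (central_graph (wheel n)) {Inl (n - 1), Inl 0}"
proof -
  define m where "m = n - 1"
  have m: "m \<ge> 3" and n: "n = Suc m" using assms by (auto simp: m_def)
  let ?G = "central_graph (wheel n)"
  let ?S = "{Inl m, Inl 0} :: (nat + nat set) set"
  have G: "simple_graph ?G"
    using assms by (intro simple_graph_central_graph simple_graph_wheel)
  have S: "?S \<subseteq> verts ?G"
    using n by (auto simp: central_graph_def verts_wheel)
  have spoke_edge: "{m, i} \<in> edges (wheel n)" if "i < m" for i
    using that by (auto simp: edges_wheel m_def)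
  have rim_edge: "{i, (i + 1) mod m} \<in> edges (wheel n)" if "i < m" for i
    using that by (auto simp: edges_wheel m_def)
  have "X = verts ?G"
    if sub: "closed_nbhd_set ?G ?S \<subseteq> X" and X: "X \<subseteq> verts ?G" and stalled: "\<nexists>Y. force_step ?G X Y"
    for X
  proof -
    have obs: "e \<in> edges (wheel n) \<Longrightarrow> m \<in> e \<or> 0 \<in> e \<Longrightarrow> Inr e \<in> X" for e
      using sub by (auto simp: closed_nbhd_set_def closed_nbhd_def nbhd_central_graph_Inl)
    have spokes: "Inr {m, i} \<in> X" if "i < m" for i
      using spoke_edge[OF that] by (intro obs) auto
    have hub: "Inl m \<in> X"
      using sub by (auto simp: closed_nbhd_set_def closed_nbhd_def)
    have "Inl i \<in> X" if "i < m" for i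
      using forced_in_stalled_set[OF stalled spokes[OF that], of "Inl i"] spoke_edge[OF that] hub
      by (auto simp: nbhd_central_graph_Inr)
    with hub have originals: "Inl v \<in> X" if "v \<in> verts (wheel n)" for v
      using that n by (auto simp: verts_wheel less_Suc_eq)
    have rim: "Inr {i, (i + 1) mod m} \<in> X" if "i < m" for i
      using that
    proof (induction i)
      case 0
      then show ?case using rim_edge[OF 0] by (intro obs) auto
    next
      case (Suc i)
      then have IH: "Inr {i, Suc i} \<in> X" by simp
      \<comment> \<open>Of the three edges at the rim vertex \<open>Suc i\<close>, only the next rim edge can still be
        unobserved, so \<open>Suc i\<close> forces it.\<close>
      have "Inr e \<in> insert (Inr {Suc i, (Suc i + 1) mod m}) X"
        if e: "e \<in> edges (wheel n)" "Suc i \<in> e" for e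
      proof -
        consider j where "j < m" "e = {j, (j + 1) mod m}" | j where "j < m" "e = {m, j}"
          using e(1) by (auto simp: edges_wheel m_def)
        then show ?thesis
        proof cases
          case 1
          then have "j = Suc i \<or> j = i" using e(2) by (auto simp: mod_Suc split: if_splits)
          then show ?thesis using 1 IH Suc.prems by auto
        next
          case 2
          then show ?thesis using spokes by auto
        qed
      qed
      then have others: "nbhd ?G (Inl (Suc i)) \<subseteq> insert (Inr {Suc i, (Suc i + 1) mod m}) X"
        using originals by (auto simp: nbhd_central_graph_Inl)
      have next_edge: "Inr {Suc i, (Suc i + 1) mod m} \<in> nbhd ?G (Inl (Suc i))"
        using rim_edge[OF Suc.prems] by (auto simp: nbhd_central_graph_Inl)
      have "Inl (Suc i) \<in> X"
        using originals Suc.prems n by (auto simp: verts_wheel)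
      then show ?case
        using others next_edge by (rule forced_in_stalled_set[OF stalled])
    qed
    have "Inr e \<in> X" if "e \<in> edges (wheel n)" for e
      using that spokes rim by (auto simp: edges_wheel m_def)
    with originals X show ?thesis by (auto simp: central_graph_def)
  qed
  then show ?thesis
    using S cl_eq_verts_iff[OF G closed_nbhd_set_subset_verts[OF G S]]
    by (auto simp: power_dominating_set_def m_def)
qed

theorem theorem38:
  fixes n :: nat
  assumes "n \<ge> 4"
  shows "power_domination_number (central_graph (wheel n)) = 2"
  unfolding power_domination_number_def
proof (rule Least_equality)
  have "card {Inl (n - 1), Inl 0 :: nat + nat set} = 2"
    using assms by simp
  then show "\<exists>S. power_dominating_set (central_graph (wheel n)) S \<and> card S = 2"
    using hub_and_rim_vertex_power_dominate[OF assms] by blast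
next
  have nonempty: "verts (wheel n) \<noteq> {}"
    by (simp add: wheel_def)
  fix k assume "\<exists>S. power_dominating_set (central_graph (wheel n)) S \<and> card S = k"
  then obtain S where S: "power_dominating_set (central_graph (wheel n)) S" "card S = k"
    by blast
  have "2 \<le> card S"
    using simple_graph_wheel[OF assms] nonempty wheel_cycle_avoiding_vertex[OF assms] S(1)
    by (rule central_graph_power_dominating_set_card)
  with S(2) show "2 \<le> k"
    by simp
qed

end
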